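(* Let $\Sigma$ be a finite alphabet with $|\Sigma|>1$, $n\ge1$, and let $B\subset\mathcal{S}_n$ be a $(1,1)$-guaranteed subset. Then the bucketing function $f^2_B$ is $(3,5)$-sensitive.
   Context: $\mathcal{S}_n=\Sigma^n$ is the set of length-$n$ sequences over $\Sigma$ with the edit (Levenshtein) distance $\mathrm{edit}$ (minimum number of single-character insertions, deletions, substitutions). For $s\in\mathcal{S}_n$ and integer $d\ge0$, $N_n^d(s)=\{t\in\mathcal{S}_n:\mathrm{edit}(s,t)\le d\}$. A bucketing function with bucket set $B$ is a map $f:\mathcal{S}_n\to\mathcal{P}(B)$; it is $(d_1,d_2)$-sensitive ($d_1<d_2$ non-negative integers) if for all $s,t\in\mathcal{S}_n$: $\mathrm{edit}(s,t)\le d_1\Rightarrow f(s)\cap f(t)\neq\emptyset$ and $\mathrm{edit}(s,t)\ge d_2\Rightarrow f(s)\cap f(t)=\emptyset$. For $B\subset\mathcal{S}_n$ and integer $r\ge1$, $f^r_B:\mathcal{S}_n\to\mathcal{P}(B)$ is defined by $f^r_B(s)=N_n^r(s)\cap B$. A subset $B\subset\mathcal{S}_n$ is $(d_1,r)$-guaranteed if $N_n^r(s)\cap N_n^r(t)\cap B\neq\emptyset$ for every pair $s,t\in\mathcal{S}_n$ with $\mathrm{edit}(s,t)\le d_1$. *)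

theory Defs
  imports Main "HOL-Library.Cardinality"
begin

text \<open>The alphabet is the universe of a type; sequences are lists over that type.\<close>

definition seqs :: "nat \<Rightarrow> 'a list set" where
  "seqs n = {s. length s = n}"

inductive single_edit :: "'a list \<Rightarrow> 'a list \<Rightarrow> bool" where
  insertion: "single_edit (xs @ ys) (xs @ c # ys)"
| deletion: "single_edit (xs @ c # ys) (xs @ ys)"
| substitution: "single_edit (xs @ c # ys) (xs @ c' # ys)"

definition edit :: "'a list \<Rightarrow> 'a list \<Rightarrow> nat" where
  "edit s t = (LEAST k. (single_edit ^^ k) s t)"

text \<open>The minimum is taken over a nonempty set: any two sequences are connected by edits.\<close>

lemma edit_reachable: "\<exists>k. (single_edit ^^ k) s t"
proof -
  have del: "single_edit\<^sup>*\<^sup>* s []" for s :: "'a list"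
  proof (induction s)
    case (Cons c s)
    have "single_edit (c # s) s" using deletion[of "[]" c s] by simp
    then show ?case using Cons.IH by (rule converse_rtranclp_into_rtranclp)
  qed simp
  have ins: "single_edit\<^sup>*\<^sup>* [] t" for t :: "'a list"
  proof (induction t)
    case (Cons c t)
    have "single_edit t (c # t)" using insertion[of "[]" t c] by simp
    with Cons.IH show ?case by (rule rtranclp.rtrancl_into_rtrancl)
  qed simp
  have "single_edit\<^sup>*\<^sup>* s t" using del ins by (rule rtranclp_trans)
  then show ?thesis by (rule rtranclp_imp_relpowp)
qed

definition nbhd :: "nat \<Rightarrow> nat \<Rightarrow> 'a list \<Rightarrow> 'a list set" where
  "nbhd n d s = {t \<in> seqs n. edit s t \<le> d}"

definition bucketing_function :: "nat \<Rightarrow> 'b set \<Rightarrow> ('a list \<Rightarrow> 'b set) \<Rightarrow> bool" where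
  "bucketing_function n B f \<longleftrightarrow> (\<forall>s \<in> seqs n. f s \<in> Pow B)"

definition sensitive ::
  "nat \<Rightarrow> 'b set \<Rightarrow> nat \<Rightarrow> nat \<Rightarrow> ('a list \<Rightarrow> 'b set) \<Rightarrow> bool" where
  "sensitive n B d1 d2 f \<longleftrightarrow>
     bucketing_function n B f \<and> d1 < d2 \<and>
     (\<forall>s \<in> seqs n. \<forall>t \<in> seqs n.
        (edit s t \<le> d1 \<longrightarrow> f s \<inter> f t \<noteq> {}) \<and>
        (edit s t \<ge> d2 \<longrightarrow> f s \<inter> f t = {}))"

definition ball_buckets :: "nat \<Rightarrow> nat \<Rightarrow> 'a list set \<Rightarrow> 'a list \<Rightarrow> 'a list set" where
  "ball_buckets n r B s = nbhd n r s \<inter> B"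

definition guaranteed :: "nat \<Rightarrow> nat \<Rightarrow> nat \<Rightarrow> 'a list set \<Rightarrow> bool" where
  "guaranteed n d1 r B \<longleftrightarrow>
     B \<subseteq> seqs n \<and>
     (\<forall>s \<in> seqs n. \<forall>t \<in> seqs n.
        edit s t \<le> d1 \<longrightarrow> nbhd n r s \<inter> nbhd n r t \<inter> B \<noteq> {})"

end

theory Submission
  imports Defs
begin

text \<open>
  Any sequence of edits can be reordered, without becoming longer, so that the substitutions come
  first, then the deletions, then the insertions. Hence two words \<open>s\<close>, \<open>t\<close> of equal length at
  distance at most 3 are joined either by three substitutions, or by at most one substitution
  \<open>s \<rightarrow> u\<close>, one deletion \<open>u \<rightarrow> w\<close> and one insertion \<open>w \<rightarrow> t\<close>. In the first case the guarantee is
  applied to the two middle words. In the second case let \<open>p\<close> be the deleted position of \<open>u\<close>.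
  Applied to \<open>u\<close> and a word differing from it exactly at \<open>p\<close>, the guarantee yields a word of \<open>B\<close>
  that agrees with \<open>u\<close> off \<open>p\<close>; deleting its position \<open>p\<close> also leads to \<open>w\<close>, so it is within
  distance 2 of \<open>t\<close>, and it is within distance 2 of \<open>s\<close>.
\<close>

definition sub_step :: "'a list \<Rightarrow> 'a list \<Rightarrow> bool" where
  "sub_step s t \<longleftrightarrow> (\<exists>xs c d ys. s = xs @ c # ys \<and> t = xs @ d # ys)"

definition del_step :: "'a list \<Rightarrow> 'a list \<Rightarrow> bool" where
  "del_step s t \<longleftrightarrow> (\<exists>xs c ys. s = xs @ c # ys \<and> t = xs @ ys)"

abbreviation ins_step :: "'a list \<Rightarrow> 'a list \<Rightarrow> bool" where
  "ins_step s t \<equiv> del_step t s"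

lemma single_edit_iff: "single_edit s t \<longleftrightarrow> sub_step s t \<or> del_step s t \<or> ins_step s t"
  unfolding sub_step_def del_step_def single_edit.simps by blast

lemma length_sub_step: "sub_step s t \<Longrightarrow> length t = length s"
  by (auto simp: sub_step_def)

lemma length_del_step: "del_step s t \<Longrightarrow> length s = Suc (length t)"
  by (auto simp: del_step_def)

lemma sub_step_sym: "sub_step s t \<Longrightarrow> sub_step t s"
  by (auto simp: sub_step_def)

lemma single_edit_sym: "single_edit s t \<Longrightarrow> single_edit t s"
  by (auto simp: single_edit_iff intro: sub_step_sym)

lemma sub_step_conv_list_update: "sub_step s t \<longleftrightarrow> (\<exists>i c. i < length s \<and> t = s[i := c])"
proof
  assume "sub_step s t"
  then obtain xs c d ys where "s = xs @ c # ys" "t = xs @ d # ys"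
    by (auto simp: sub_step_def)
  then have "length xs < length s \<and> t = s[length xs := d]"
    by simp
  then show "\<exists>i c. i < length s \<and> t = s[i := c]"
    by blast
next
  assume "\<exists>i c. i < length s \<and> t = s[i := c]"
  then obtain i c where "i < length s" "t = s[i := c]"
    by blast
  then show "sub_step s t"
    unfolding sub_step_def by (metis id_take_nth_drop upd_conv_take_nth_drop)
qed

lemma del_sub_swap:
  assumes "del_step s w" "sub_step w t"
  shows "\<exists>u. sub_step s u \<and> del_step u t"
proof -
  obtain xs c ys where 1: "s = xs @ c # ys" "w = xs @ ys"
    using assms(1) by (auto simp: del_step_def)
  obtain us d e vs where 2: "w = us @ d # vs" "t = us @ e # vs"
    using assms(2) by (auto simp: sub_step_def)
  have "xs @ ys = us @ d # vs"
    using 1 2 by simp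
  then consider zs where "xs = us @ d # zs" "vs = zs @ ys" | zs where "us = xs @ zs" "ys = zs @ d # vs"
    by (auto simp: append_eq_append_conv2 append_eq_Cons_conv Cons_eq_append_conv)
  then show ?thesis
  proof cases
    case 1
    have "sub_step s (us @ e # zs @ c # ys)"
      unfolding sub_step_def \<open>s = _\<close> 1 by (metis append.assoc append_Cons)
    moreover have "del_step (us @ e # zs @ c # ys) t"
      unfolding del_step_def \<open>t = _\<close> 1 by (metis append.assoc append_Cons)
    ultimately show ?thesis by blast
  next
    case 2
    have "sub_step s (xs @ c # zs @ e # vs)"
      unfolding sub_step_def \<open>s = _\<close> 2 by (metis append.assoc append_Cons)
    moreover have "del_step (xs @ c # zs @ e # vs) t"
      unfolding del_step_def \<open>t = _\<close> 2 by (metis append.assoc)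
    ultimately show ?thesis by blast
  qed
qed

lemma ins_sub_swap:
  assumes "ins_step s w" "sub_step w t"
  shows "ins_step s t \<or> (\<exists>u. sub_step s u \<and> ins_step u t)"
proof -
  obtain xs c ys where 1: "w = xs @ c # ys" "s = xs @ ys"
    using assms(1) by (auto simp: del_step_def)
  obtain us d e vs where 2: "w = us @ d # vs" "t = us @ e # vs"
    using assms(2) by (auto simp: sub_step_def)
  have "xs @ c # ys = us @ d # vs"
    using 1 2 by simp
  then consider "xs = us" "ys = vs" | zs where "xs = us @ d # zs" "vs = zs @ c # ys"
    | zs where "us = xs @ c # zs" "ys = zs @ d # vs"
    by (auto simp: append_eq_append_conv2 append_eq_Cons_conv Cons_eq_append_conv)
  then show ?thesis
  proof cases
    case 1
    then show ?thesis
      unfolding del_step_def \<open>s = _\<close> \<open>t = _\<close> by blast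
  next
    case 2
    have "sub_step s (us @ e # zs @ ys)"
      unfolding sub_step_def \<open>s = _\<close> 2 by (metis append.assoc append_Cons)
    moreover have "ins_step (us @ e # zs @ ys) t"
      unfolding del_step_def \<open>t = _\<close> 2 by (metis append.assoc append_Cons)
    ultimately show ?thesis by blast
  next
    case 3
    have "sub_step s (xs @ zs @ e # vs)"
      unfolding sub_step_def \<open>s = _\<close> 3 by (metis append.assoc)
    moreover have "ins_step (xs @ zs @ e # vs) t"
      unfolding del_step_def \<open>t = _\<close> 3 by (metis append.assoc append_Cons)
    ultimately show ?thesis by blast
  qed
qed

lemma ins_del_swap:
  assumes "ins_step s w" "del_step w t"
  shows "s = t \<or> (\<exists>u. del_step s u \<and> ins_step u t)"
proof -
  obtain xs c ys where 1: "w = xs @ c # ys" "s = xs @ ys"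
    using assms(1) by (auto simp: del_step_def)
  obtain us d vs where 2: "w = us @ d # vs" "t = us @ vs"
    using assms(2) by (auto simp: del_step_def)
  have "xs @ c # ys = us @ d # vs"
    using 1 2 by simp
  then consider "xs = us" "ys = vs" | zs where "xs = us @ d # zs" "vs = zs @ c # ys"
    | zs where "us = xs @ c # zs" "ys = zs @ d # vs"
    by (auto simp: append_eq_append_conv2 append_eq_Cons_conv Cons_eq_append_conv)
  then show ?thesis
  proof cases
    case 1
    then show ?thesis
      unfolding \<open>s = _\<close> \<open>t = _\<close> by blast
  next
    case 2
    have "del_step s (us @ zs @ ys)"
      unfolding del_step_def \<open>s = _\<close> 2 by (metis append.assoc append_Cons)
    moreover have "ins_step (us @ zs @ ys) t"
      unfolding del_step_def \<open>t = _\<close> 2 by (metis append.assoc)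
    ultimately show ?thesis by blast
  next
    case 3
    have "del_step s (xs @ zs @ vs)"
      unfolding del_step_def \<open>s = _\<close> 3 by (metis append.assoc)
    moreover have "ins_step (xs @ zs @ vs) t"
      unfolding del_step_def \<open>t = _\<close> 3 by (metis append.assoc append_Cons)
    ultimately show ?thesis by blast
  qed
qed

lemma dels_sub_swap:
  assumes "(del_step ^^ b) s w" "sub_step w t"
  shows "\<exists>u. sub_step s u \<and> (del_step ^^ b) u t"
  using assms
proof (induction b arbitrary: w t)
  case (Suc b)
  then obtain v where "(del_step ^^ b) s v" "del_step v w"
    by auto
  then show ?case
    using Suc.IH Suc.prems(2) del_sub_swap[of v w t] by (metis relpowp_Suc_I)
qed auto

lemma inss_sub_swap:
  assumes "(ins_step ^^ c) s w" "sub_step w t"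
  shows "(ins_step ^^ c) s t \<or> (\<exists>u. sub_step s u \<and> (ins_step ^^ c) u t)"
  using assms
proof (induction c arbitrary: w t)
  case (Suc c)
  then obtain v where v: "(ins_step ^^ c) s v" "ins_step v w"
    by auto
  from ins_sub_swap[OF v(2) Suc.prems(2)] show ?case
  proof
    assume "ins_step v t"
    then show ?thesis
      using v(1) by auto
  next
    assume "\<exists>u. sub_step v u \<and> ins_step u t"
    then show ?thesis
      using Suc.IH[OF v(1)] by (metis (no_types, lifting) relpowp_Suc_I)
  qed
qed auto

lemma inss_del_swap:
  assumes "(ins_step ^^ c) s w" "del_step w t"
  shows "(\<exists>c'<c. (ins_step ^^ c') s t) \<or> (\<exists>u. del_step s u \<and> (ins_step ^^ c) u t)"
  using assms
proof (induction c arbitrary: w t)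
  case (Suc c)
  then obtain v where v: "(ins_step ^^ c) s v" "ins_step v w"
    by auto
  from ins_del_swap[OF v(2) Suc.prems(2)] show ?case
  proof
    assume "v = t"
    then show ?thesis
      using v(1) by blast
  next
    assume "\<exists>u. del_step v u \<and> ins_step u t"
    then obtain u where u: "del_step v u" "ins_step u t"
      by blast
    from Suc.IH[OF v(1) u(1)] show ?thesis
    proof
      assume "\<exists>c'<c. (ins_step ^^ c') s u"
      then obtain c' where "c' < c" "(ins_step ^^ c') s u"
        by blast
      then have "Suc c' < Suc c" "(ins_step ^^ Suc c') s t"
        using u(2) by auto
      then show ?thesis
        by blast
    next
      assume "\<exists>x. del_step s x \<and> (ins_step ^^ c) x u"
      then show ?thesis
        using u(2) by (metis (no_types, lifting) relpowp_Suc_I)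
    qed
  qed
qed auto

lemma edits_normal_form:
  assumes "(single_edit ^^ k) s t"
  obtains a b c u w where "a + b + c \<le> k"
    "(sub_step ^^ a) s u" "(del_step ^^ b) u w" "(ins_step ^^ c) w t"
proof -
  have "\<exists>a b c u w. a + b + c \<le> k \<and> (sub_step ^^ a) s u \<and> (del_step ^^ b) u w \<and> (ins_step ^^ c) w t"
    using assms
  proof (induction k arbitrary: t)
    case 0
    have "0 + 0 + 0 \<le> (0::nat) \<and> (sub_step ^^ 0) s s \<and> (del_step ^^ 0) s s \<and> (ins_step ^^ 0) s t"
      using 0 by auto
    then show ?case by blast
  next
    case (Suc k)
    then obtain v where v: "(single_edit ^^ k) s v" "single_edit v t"
      by auto
    from Suc.IH[OF v(1)] obtain a b c u w where
      *: "a + b + c \<le> k" "(sub_step ^^ a) s u" "(del_step ^^ b) u w" "(ins_step ^^ c) w v"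
      by blast
    from v(2) consider "sub_step v t" | "del_step v t" | "ins_step v t"
      by (auto simp: single_edit_iff)
    then show ?case
    proof cases
      case 1
      from inss_sub_swap[OF *(4) 1] show ?thesis
      proof
        assume "(ins_step ^^ c) w t"
        then show ?thesis
          using * le_SucI by blast
      next
        assume "\<exists>x. sub_step w x \<and> (ins_step ^^ c) x t"
        then obtain x where x: "sub_step w x" "(ins_step ^^ c) x t"
          by blast
        from dels_sub_swap[OF *(3) x(1)] obtain y where "sub_step u y" "(del_step ^^ b) y x"
          by blast
        moreover from this have "(sub_step ^^ Suc a) s y"
          using *(2) by auto
        moreover have "Suc a + b + c \<le> Suc k"
          using *(1) by simp
        ultimately show ?thesis
          using x(2) by blast
      qed
    next
      case 2
      from inss_del_swap[OF *(4) 2] show ?thesis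
      proof
        assume "\<exists>c'<c. (ins_step ^^ c') w t"
        then obtain c' where "c' < c" "(ins_step ^^ c') w t"
          by blast
        moreover from this have "a + b + c' \<le> Suc k"
          using *(1) by simp
        ultimately show ?thesis
          using *(2,3) by blast
      next
        assume "\<exists>x. del_step w x \<and> (ins_step ^^ c) x t"
        then obtain x where "del_step w x" "(ins_step ^^ c) x t"
          by blast
        moreover from this have "(del_step ^^ Suc b) u x"
          using *(3) by auto
        moreover have "a + Suc b + c \<le> Suc k"
          using *(1) by simp
        ultimately show ?thesis
          using *(2) by blast
      qed
    next
      case 3
      then have "(ins_step ^^ Suc c) w t"
        using *(4) by auto
      moreover have "a + b + Suc c \<le> Suc k"
        using *(1) by simp
      ultimately show ?thesis
        using *(2,3) by blast
    qed
  qed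
  then show ?thesis
    using that by blast
qed

lemma length_subs: "(sub_step ^^ a) s t \<Longrightarrow> length t = length s"
  by (induction a arbitrary: t) (auto dest: length_sub_step)

lemma length_dels: "(del_step ^^ b) s t \<Longrightarrow> length s = b + length t"
  by (induction b arbitrary: t) (fastforce dest: length_del_step)+

lemma length_inss: "(ins_step ^^ c) s t \<Longrightarrow> length t = c + length s"
  by (induction c arbitrary: t) (fastforce dest: length_del_step)+

lemma edits_edit: "(single_edit ^^ edit s t) s t"
  unfolding edit_def by (rule LeastI_ex) (rule edit_reachable)

lemma edit_le: "(single_edit ^^ k) s t \<Longrightarrow> edit s t \<le> k"
  unfolding edit_def by (rule Least_le)

lemma edit_triangle: "edit s u \<le> edit s t + edit t u"
  by (rule edit_le) (use edits_edit relpowp_trans in metis)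

lemma edits_sym: "(single_edit ^^ k) s t \<Longrightarrow> (single_edit ^^ k) t s"
proof (induction k arbitrary: t)
  case (Suc k)
  then show ?case
    by (metis relpowp_Suc_E relpowp_Suc_I2 single_edit_sym)
qed auto

lemma edit_commute: "edit s t = edit t s"
  by (rule antisym) (auto intro: edit_le edits_sym edits_edit)

lemma edit_self [simp]: "edit s s = 0"
  using edit_le[of 0 s s] by simp

lemma edit_single_edit: "single_edit s t \<Longrightarrow> edit s t \<le> 1"
  using edit_le[of 1 s t] by (simp add: eq_OO)

lemma edit_sub_step: "sub_step s t \<Longrightarrow> edit s t \<le> 1"
  by (intro edit_single_edit) (simp add: single_edit_iff)

lemma edit_del_step: "del_step s t \<Longrightarrow> edit s t \<le> 1"
  by (intro edit_single_edit) (simp add: single_edit_iff)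

lemma edit_le_1_same_length:
  assumes "edit s t \<le> 1" "length s = length t"
  shows "s = t \<or> sub_step s t"
proof (cases "edit s t = 0")
  case True
  then show ?thesis
    using edits_edit[of s t] by simp
next
  case False
  then have "edit s t = 1"
    using assms(1) by simp
  then have "single_edit s t"
    using edits_edit[of s t] by (simp add: eq_OO)
  then show ?thesis
    using assms(2) length_del_step[of s t] length_del_step[of t s] by (auto simp: single_edit_iff)
qed

lemma edit_le_3_cases:
  assumes "edit s t \<le> 3" "length s = length t"
  obtains (subs) u v where "length u = length s" "length v = length s"
      "edit s u \<le> 1" "edit u v \<le> 1" "edit v t \<le> 1"
  | (indel) u w where "length u = length s" "edit s u \<le> 1" "del_step u w" "ins_step w t"
proof -
  obtain a b c u w where *: "a + b + c \<le> edit s t"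
    "(sub_step ^^ a) s u" "(del_step ^^ b) u w" "(ins_step ^^ c) w t"
    using edits_normal_form[OF edits_edit] by blast
  note len = length_subs[OF *(2)] length_dels[OF *(3)] length_inss[OF *(4)]
  then have "b = c"
    using assms(2) by simp
  then consider "b = 0" "c = 0" "a \<in> {0, 1, 2, 3}" | "b = 1" "c = 1" "a \<in> {0, 1}"
    using *(1) assms(1) by force
  then show ?thesis
  proof cases
    case 1
    then have "(sub_step ^^ a) s t"
      using * by simp
    moreover have "\<exists>u v. length u = length s \<and> length v = length s \<and>
        (s = u \<or> sub_step s u) \<and> (u = v \<or> sub_step u v) \<and> (v = t \<or> sub_step v t)"
      if "(sub_step ^^ a) s t"
      using that 1(3) by (auto simp: numeral_eq_Suc OO_def) (metis length_sub_step)+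
    ultimately show ?thesis
      using subs edit_sub_step by (metis edit_self zero_le_one)
  next
    case 2
    then have "s = u \<or> sub_step s u"
      using *(2) by auto
    then have "edit s u \<le> 1"
      using edit_sub_step by auto
    then show ?thesis
      using indel[of u w] * 2 len by (simp add: eq_OO)
  qed
qed

lemma common_sub_neighbour_on_line:
  assumes p: "p < length u" and c: "c \<noteq> u ! p"
    and 1: "u = b \<or> sub_step u b" and 2: "u[p := c] = b \<or> sub_step (u[p := c]) b"
  obtains e where "b = u[p := e]"
proof -
  obtain i d where i: "b = u[i := d]"
    using 1 by (metis list_update_id sub_step_conv_list_update)
  obtain j e where j: "b = u[p := c, j := e]"
    using 2 by (metis list_update_id sub_step_conv_list_update)
  show ?thesis
  proof (cases "i = p \<or> j = p")
    case True
    then show ?thesis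
      using i j that by (metis list_update_overwrite)
  next
    case False
    then show ?thesis
      using i j p c by (metis nth_list_update_eq nth_list_update_neq length_list_update)
  qed
qed

lemma guaranteed_1_1_line:
  fixes B :: "'a::finite list set"
  assumes "CARD('a) > 1" "guaranteed n 1 1 B" "length u = n" "p < n"
  obtains e where "u[p := e] \<in> B"
proof -
  obtain c where c: "c \<noteq> u ! p"
  proof -
    have "\<not> UNIV \<subseteq> {u ! p}"
      using assms(1) card_mono[of "{u ! p}" UNIV] by auto
    then show ?thesis
      using that by blast
  qed
  let ?v = "u[p := c]"
  have "sub_step u ?v"
    using assms(3,4) by (auto simp: sub_step_conv_list_update)
  then have "edit u ?v \<le> 1"
    by (rule edit_sub_step)
  then obtain b where b: "b \<in> B" "length b = n" "edit u b \<le> 1" "edit ?v b \<le> 1"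
    using assms(2,3) unfolding guaranteed_def seqs_def nbhd_def by fastforce
  have "u = b \<or> sub_step u b" "?v = b \<or> sub_step ?v b"
    using b assms(3) by (simp_all add: edit_le_1_same_length)
  then obtain e where "b = u[p := e]"
    using common_sub_neighbour_on_line c assms(3,4) by metis
  then show ?thesis
    using b(1) that by blast
qed

lemma guaranteed_1_1_common_bucket:
  fixes B :: "'a::finite list set"
  assumes "CARD('a) > 1" "guaranteed n 1 1 B"
    and len: "length s = n" "length t = n" and "edit s t \<le> 3"
  obtains b where "b \<in> B" "edit s b \<le> 2" "edit t b \<le> 2"
proof -
  have "length s = length t"
    using len by simp
  with \<open>edit s t \<le> 3\<close> show ?thesis
  proof (cases rule: edit_le_3_cases)
    case (subs u v)
    then obtain b where b: "b \<in> B" "edit u b \<le> 1" "edit v b \<le> 1"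
      using assms(2) len unfolding guaranteed_def seqs_def nbhd_def by fastforce
    have "edit s b \<le> 2" "edit t b \<le> 2"
      using b subs edit_triangle[of s b u] edit_triangle[of t b v] edit_commute[of t v] by auto
    then show ?thesis
      using b(1) that by blast
  next
    case (indel u w)
    then obtain xs c ys where u: "u = xs @ c # ys" and w: "w = xs @ ys"
      by (auto simp: del_step_def)
    then obtain e where e: "u[length xs := e] \<in> B"
      using guaranteed_1_1_line[OF assms(1,2), of u "length xs"] indel(1) len by auto
    define b where "b = xs @ e # ys"
    have b: "b \<in> B"
      using e u b_def by simp
    have "sub_step u b" "del_step b w"
      unfolding sub_step_def del_step_def u w b_def by blast+
    then have "edit u b \<le> 1" "edit b w \<le> 1" "edit t w \<le> 1"
      using edit_sub_step edit_del_step indel(4) by blast+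
    then have "edit s b \<le> 2" "edit t b \<le> 2"
      using indel(2) edit_triangle[of s b u] edit_triangle[of t b w] edit_commute[of b w] by auto
    then show ?thesis
      using b that by blast
  qed
qed

theorem theorem2:
  fixes B :: "('a :: finite) list set" and n :: nat
  assumes "CARD('a) > 1"
    and "n \<ge> 1"
    and "guaranteed n 1 1 B"
  shows "sensitive n B 3 5 (ball_buckets n 2 B)"
proof -
  have B: "B \<subseteq> seqs n"
    using assms(3) by (simp add: guaranteed_def)
  have near: "ball_buckets n 2 B s \<inter> ball_buckets n 2 B t \<noteq> {}"
    if st: "s \<in> seqs n" "t \<in> seqs n" "edit s t \<le> 3" for s t
  proof -
    obtain b where "b \<in> B" "edit s b \<le> 2" "edit t b \<le> 2"
      using guaranteed_1_1_common_bucket[OF assms(1,3), of s t] st by (auto simp: seqs_def)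
    then have "b \<in> ball_buckets n 2 B s \<inter> ball_buckets n 2 B t"
      using B by (auto simp: ball_buckets_def nbhd_def)
    then show ?thesis
      by blast
  qed
  have far: "ball_buckets n 2 B s \<inter> ball_buckets n 2 B t = {}" if "edit s t \<ge> 5" for s t
  proof -
    have False if "edit s b \<le> 2" "edit t b \<le> 2" for b
      using that \<open>edit s t \<ge> 5\<close> edit_triangle[of s t b] edit_commute[of t b] by simp
    then show ?thesis
      by (auto simp: ball_buckets_def nbhd_def)
  qed
  show ?thesis
    using near far by (auto simp: sensitive_def bucketing_function_def ball_buckets_def)
qed

end
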